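(* Let $\mathbb{I}$ be a discrete interval unbounded above, $(X,d)$ a complete metric space, $U\subseteq X$ nonempty and closed, and for each $n\in\mathbb{N}_0$ let $\mathscr{F}_t^n:U\to U$, $t\in\mathbb{I}$, be continuous. Let $\varphi^n$ be the general solution of $(\Delta_n)$: $u_{t+1}=\mathscr{F}_t^n(u_t)$, and $\mathcal{U}:=\mathbb{I}\times U$. Suppose a bounded nonautonomous set $\mathcal{A}\subseteq\mathcal{U}$ is positively invariant for every $(\Delta_n)$, $n\in\mathbb{N}_0$. If each $(\Delta_n)$, $n\in\mathbb{N}_0$, is strongly $\mathcal{A}$-asymptotically compact with a compact $K_n\subseteq U$, then its forward limit set $\omega_{\mathcal{A},n}^+\subseteq K_n$ is nonempty, compact and forward attracts $\mathcal{A}$. If, with $K:=\bigcup_{n\in\mathbb{N}_0}K_n$, moreover (i) $\omega_{\mathcal{A},0}^+$ attracts $K$ uniformly in $\tau\in\mathbb{I}$, i.e. $\lim_{s\to\infty}\sup_{\tau\in\mathbb{I}}\operatorname{dist}\bigl(\varphi^0(\tau+s;\tau,K),\omega_{\mathcal{A},0}^+\bigr)=0$, (ii) for every sequence $((s_k,\tau_k))_{k\in\mathbb{N}}$ in $\mathbb{N}\times\mathbb{I}$ with $\tau_k\to\infty$ as $k\to\infty$ one has $\lim_{k\to\infty}\operatorname{dist}\bigl(\varphi^n(\tau_k+s_k;\tau_k,K_n),K_n\bigr)=0$ for all $n\in\mathbb{N}_0$, (iii) for all $\varepsilon>0$, $S\in\mathbb{N}$ and $n\in\mathbb{N}_0$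 there exists a $\delta>0$ such that for all $\tau\in\mathbb{I}$ and all $u,v\in\mathcal{A}(\tau)\cup K_n$ with $d(u,v)<\delta$ one has $\max_{0<s\le S}d(\varphi^n(\tau+s;\tau,u),\varphi^n(\tau+s;\tau,v))<\varepsilon$, (iv) for all $\varepsilon>0$, $S\in\mathbb{N}$ there exists an $n_0\in\mathbb{N}$ such that for all $\tau\in\mathbb{I}$, all $u\in\mathcal{A}(\tau)\cup K$ and all $n>n_0$ one has $\max_{0<s\le S}d(\varphi^n(\tau+s;\tau,u),\varphi^0(\tau+s;\tau,u))<\varepsilon$ hold, then $\lim_{n\to\infty}\operatorname{dist}(\omega_{\mathcal{A},n}^+,\omega_{\mathcal{A},0}^+)=0$.
   Context: A discrete interval is the intersection of a real interval with $\mathbb{Z}$; $\mathbb{N}=\{1,2,\dots\}$, $\mathbb{N}_0=\{0,1,2,\dots\}$; $s,t$ denote integers. The general solution is $\varphi^n(\tau;\tau,u)=u$ and $\varphi^n(t;\tau,u)=\mathscr{F}^n_{t-1}\circ\cdots\circ\mathscr{F}^n_\tau(u)$ for $\tau<t$, $u\in U$. A nonautonomous set $\mathcal{A}\subseteq\mathcal{U}$ has nonempty fibers $\mathcal{A}(t)=\{x:(t,x)\in\mathcal{A}\}$, $t\in\mathbb{I}$; it is bounded if there are $R>0$, $x_0\in X$ with $\mathcal{A}(t)\subseteq B_R(x_0)$ for all $t\in\mathbb{I}$; positively invariant for $(\Delta_n)$ if $\mathscr{F}^n_t(\mathcal{A}(t))\subseteq\mathcal{A}(t+1)$ for all $t\in\mathbb{I}$.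 The Hausdorff semidistance is $\operatorname{dist}(A,B)=\sup_{a\in A}\inf_{b\in B}d(a,b)$. $(\Delta_n)$ is strongly $\mathcal{A}$-asymptotically compact with $K_n$ if $K_n\subseteq U$ is nonempty, compact and every sequence $((s_k,\tau_k))_{k\in\mathbb{N}}$ in $\mathbb{N}\times\mathbb{I}$ with $s_k\to\infty$, $\tau_k\to\infty$ satisfies $\lim_{k\to\infty}\operatorname{dist}(\varphi^n(\tau_k+s_k;\tau_k,\mathcal{A}(\tau_k)),K_n)=0$. Forward limit set of $(\Delta_n)$: with $\Omega_{\mathcal{A},n}(\tau):=\bigcap_{0\le s}\overline{\bigcup_{s\le t}\varphi^n(\tau+t;\tau,\mathcal{A}(\tau))}$, put $\omega_{\mathcal{A},n}^+:=\overline{\bigcup_{\tau\in\mathbb{I}}\Omega_{\mathcal{A},n}(\tau)}$. A set $\omega\subseteq U$ forward attracts $\mathcal{A}$ (for $(\Delta_n)$) if $\lim_{s\to\infty}\operatorname{dist}(\varphi^n(\tau+s;\tau,\mathcal{A}(\tau)),\omega)=0$ for all $\tau\in\mathbb{I}$. *)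

theory Defs
  imports "HOL-Analysis.Analysis"
begin

definition discrete_interval :: "int set \<Rightarrow> bool" where
  "discrete_interval I \<longleftrightarrow> (\<exists>J::real set. is_interval J \<and> I = {t. real_of_int t \<in> J})"

text \<open>The value at \<open>t\<close> is the composition \<open>f (t - 1) \<circ> \<dots> \<circ> f \<tau>\<close> applied to \<open>u\<close>. The function
  is only meaningful for \<open>\<tau> \<le> t\<close>; for \<open>t < \<tau>\<close> the list is empty and the value is \<open>u\<close>.\<close>

definition gen_sol :: "(int \<Rightarrow> 'a \<Rightarrow> 'a) \<Rightarrow> int \<Rightarrow> int \<Rightarrow> 'a \<Rightarrow> 'a" where
  "gen_sol f t \<tau> u = fold f [\<tau>..t - 1] u"

lemma gen_sol_refl: "gen_sol f \<tau> \<tau> u = u"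
  by (simp add: gen_sol_def)

lemma gen_sol_step: "\<tau> \<le> t \<Longrightarrow> gen_sol f (t + 1) \<tau> u = f t (gen_sol f t \<tau> u)"
  by (simp add: gen_sol_def upto_rec2)

definition fiber :: "(int \<times> 'a) set \<Rightarrow> int \<Rightarrow> 'a set" where
  "fiber A t = {x. (t, x) \<in> A}"

definition nonautonomous_set :: "int set \<Rightarrow> 'a set \<Rightarrow> (int \<times> 'a) set \<Rightarrow> bool" where
  "nonautonomous_set I U A \<longleftrightarrow> A \<subseteq> I \<times> U \<and> (\<forall>t\<in>I. fiber A t \<noteq> {})"

definition bounded_nonautonomous :: "int set \<Rightarrow> (int \<times> 'a::metric_space) set \<Rightarrow> bool" where
  "bounded_nonautonomous I A \<longleftrightarrow> (\<exists>R>0. \<exists>x0. \<forall>t\<in>I. fiber A t \<subseteq> ball x0 R)"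

definition positively_invariant ::
  "int set \<Rightarrow> (int \<Rightarrow> 'a \<Rightarrow> 'a) \<Rightarrow> (int \<times> 'a) set \<Rightarrow> bool" where
  "positively_invariant I f A \<longleftrightarrow> (\<forall>t\<in>I. f t ` fiber A t \<subseteq> fiber A (t + 1))"

text \<open>The semidistance takes values in \<open>[0, \<infinity>]\<close>, since the supremum may be infinite for
  unbounded first arguments; the first argument \<open>{}\<close> yields \<open>0\<close>.\<close>

definition hausdorff_semidist :: "'a::metric_space set \<Rightarrow> 'a set \<Rightarrow> ennreal" where
  "hausdorff_semidist A B = (SUP a\<in>A. INF b\<in>B. ennreal (dist a b))"

definition strongly_asymptotically_compact ::
  "int set \<Rightarrow> 'a::metric_space set \<Rightarrow> (int \<Rightarrow> 'a \<Rightarrow> 'a) \<Rightarrow> (int \<times> 'a) set \<Rightarrow> 'a set \<Rightarrow> bool" where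
  "strongly_asymptotically_compact I U f A K \<longleftrightarrow>
     K \<subseteq> U \<and> K \<noteq> {} \<and> compact K \<and>
     (\<forall>(s :: nat \<Rightarrow> int) (\<tau> :: nat \<Rightarrow> int).
        (\<forall>k. 1 \<le> s k \<and> \<tau> k \<in> I) \<and>
        filterlim s at_top sequentially \<and> filterlim \<tau> at_top sequentially \<longrightarrow>
        (\<lambda>k. hausdorff_semidist (gen_sol f (\<tau> k + s k) (\<tau> k) ` fiber A (\<tau> k)) K)
          \<longlonglongrightarrow> 0)"

definition Omega_fiber ::
  "(int \<Rightarrow> 'a::metric_space \<Rightarrow> 'a) \<Rightarrow> (int \<times> 'a) set \<Rightarrow> int \<Rightarrow> 'a set" where
  "Omega_fiber f A \<tau> = (\<Inter>s\<in>{0..}. closure (\<Union>t\<in>{s..}. gen_sol f (\<tau> + t) \<tau> ` fiber A \<tau>))"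

definition forward_limit_set ::
  "int set \<Rightarrow> (int \<Rightarrow> 'a::metric_space \<Rightarrow> 'a) \<Rightarrow> (int \<times> 'a) set \<Rightarrow> 'a set" where
  "forward_limit_set I f A = closure (\<Union>\<tau>\<in>I. Omega_fiber f A \<tau>)"

definition forward_attracts ::
  "int set \<Rightarrow> 'a::metric_space set \<Rightarrow> (int \<Rightarrow> 'a \<Rightarrow> 'a) \<Rightarrow> (int \<times> 'a) set \<Rightarrow> 'a set \<Rightarrow> bool" where
  "forward_attracts I U f A \<omega> \<longleftrightarrow>
     \<omega> \<subseteq> U \<and>
     (\<forall>\<tau>\<in>I. ((\<lambda>s. hausdorff_semidist (gen_sol f (\<tau> + s) \<tau> ` fiber A \<tau>) \<omega>) \<longlongrightarrow> 0) at_top)"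

end

theory Submission
  imports Defs
begin

text \<open>
  The key observation is that positive invariance allows the evolution from
  \<open>\<tau>\<close> to be restarted at any later time \<open>\<sigma>\<close> from a point of the fiber of \<open>A\<close> at \<open>\<sigma>\<close>
  (lemmas \<open>gen_sol_cocycle\<close> and \<open>gen_sol_in_fiber\<close>).

  Strong asymptotic compactness controls only late initial times. Restarting at a late time
  turns it into attraction by \<open>K n\<close> for every fixed initial time (lemma
  \<open>eventually_gen_sol_near_compact\<close>). A family of nonempty sets attracted by a compact set has
  a nonempty limit set in this compact set, and the limit set itself attracts the family (lemma
  \<open>limit_set_of_compactly_attracted\<close>). The forward limit set is the closure of the union of
  these limit sets, so that it is a closed subset of \<open>K n\<close> and attracts every one of the families.

  For the upper semicontinuity, a point of the forward limit set of the \<open>n\<close>-th equation is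
  approximated by values \<open>x = gen_sol (F n) (\<tau> + t) \<tau> a\<close> with \<open>a\<close> in the fiber of \<open>A\<close> at \<open>\<tau>\<close>
  and arbitrarily large \<open>t\<close>. A time span \<open>S\<close> is chosen such that the
  unperturbed flow takes \<open>\<Union>n. K n\<close> into a small neighbourhood of the unperturbed limit set
  after \<open>S\<close> steps, whatever the initial time. The evolution of \<open>x\<close> is interrupted \<open>S\<close> steps
  before its end: there the state is
  close to some \<open>z \<in> K n\<close>. Over the remaining \<open>S\<close> steps, equicontinuity replaces the state by
  \<open>z\<close>, convergence of the solutions over \<open>S\<close> steps replaces \<open>F n\<close> by \<open>F 0\<close>, and the choice of \<open>S\<close>
  takes \<open>z\<close> close to the unperturbed limit set. This is lemma
  \<open>forward_limit_set_near\<close>; since \<open>S\<close> and the bound on \<open>n\<close> depend only on the accuracy,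
  the estimate is uniform over the limit set.
\<close>

section \<open>The Hausdorff semidistance\<close>

lemma hausdorff_semidist_lessD:
  assumes "hausdorff_semidist A B < ennreal e" and "a \<in> A"
  shows "\<exists>b\<in>B. dist a b < e"
proof -
  have "(INF b\<in>B. ennreal (dist a b)) \<le> hausdorff_semidist A B"
    unfolding hausdorff_semidist_def using assms(2) by (rule SUP_upper)
  with assms(1) have "(INF b\<in>B. ennreal (dist a b)) < ennreal e" by (rule le_less_trans[rotated])
  then obtain b where "b \<in> B" "ennreal (dist a b) < ennreal e" by (auto simp: INF_less_iff)
  then show ?thesis by (auto simp: ennreal_less_iff)
qed

lemma hausdorff_semidist_leI:
  assumes "\<And>a. a \<in> A \<Longrightarrow> \<exists>b\<in>B. dist a b \<le> e"
  shows "hausdorff_semidist A B \<le> ennreal e"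
  unfolding hausdorff_semidist_def
proof (rule SUP_least)
  fix a assume "a \<in> A"
  with assms obtain b where "b \<in> B" "dist a b \<le> e" by blast
  then show "(INF b\<in>B. ennreal (dist a b)) \<le> ennreal e"
    by (meson INF_lower ennreal_leI order_trans)
qed

lemma eventually_less_of_tendsto_0_ennreal:
  fixes f :: "'b \<Rightarrow> ennreal"
  assumes "(f \<longlongrightarrow> 0) G" and "0 < (e::real)"
  shows "eventually (\<lambda>x. f x < ennreal e) G"
  using order_tendstoD(2)[OF assms(1), of "ennreal e"] assms(2) by simp

lemma tendsto_hausdorff_semidist_0_iff:
  "((\<lambda>x. hausdorff_semidist (A x) B) \<longlongrightarrow> 0) G \<longleftrightarrow>
    (\<forall>e>0. eventually (\<lambda>x. \<forall>a\<in>A x. \<exists>b\<in>B. dist a b < e) G)" (is "?L \<longleftrightarrow> ?R")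
proof
  assume L: ?L
  show ?R
  proof (intro allI impI)
    fix e :: real assume "e > 0"
    with L have "eventually (\<lambda>x. hausdorff_semidist (A x) B < ennreal e) G"
      by (rule eventually_less_of_tendsto_0_ennreal)
    then show "eventually (\<lambda>x. \<forall>a\<in>A x. \<exists>b\<in>B. dist a b < e) G"
      by eventually_elim (blast intro: hausdorff_semidist_lessD)
  qed
next
  assume R: ?R
  show ?L
  proof (rule order_tendstoI)
    fix c :: ennreal assume "0 < c"
    then obtain d where d: "0 < d" "d < c" by (rule dense[THEN exE]) blast
    define e where "e = enn2real d"
    have "d < top" using d(2) by (rule less_le_trans) simp
    with d have e: "0 < e" "ennreal e < c"
      by (simp_all add: e_def enn2real_positive_iff)
    with R have "eventually (\<lambda>x. \<forall>a\<in>A x. \<exists>b\<in>B. dist a b < e) G" by blast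
    then show "eventually (\<lambda>x. hausdorff_semidist (A x) B < c) G"
    proof eventually_elim
      case (elim x)
      then have "hausdorff_semidist (A x) B \<le> ennreal e"
        by (intro hausdorff_semidist_leI) (meson less_imp_le)
      with e show ?case by simp
    qed
  qed simp
qed

section \<open>Limit sets of families attracted by a compact set\<close>

text \<open>If points of \<open>B t\<close> stayed away from the limit set for arbitrarily large \<open>t\<close>, then
  compactness of \<open>K\<close> would provide an accumulation point of them, and every such accumulation
  point lies in the limit set. Nonemptiness comes for free, because nothing can be close to the
  empty set.\<close>

lemma limit_set_of_compactly_attracted:
  fixes B :: "int \<Rightarrow> 'a::metric_space set"
  defines "L \<equiv> \<Inter>s\<in>{0..}. closure (\<Union>t\<in>{s..}. B t)"
  assumes "compact K"
    and attr: "\<And>e. e > 0 \<Longrightarrow> eventually (\<lambda>t. \<forall>x\<in>B t. \<exists>y\<in>K. dist x y < e) at_top"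
  shows "L \<subseteq> K"
    and "\<And>e. e > 0 \<Longrightarrow> eventually (\<lambda>t. \<forall>x\<in>B t. \<exists>y\<in>L. dist x y < e) at_top"
    and "(\<And>t. B t \<noteq> {}) \<Longrightarrow> L \<noteq> {}"
proof -
  show "L \<subseteq> K"
  proof
    fix x assume x: "x \<in> L"
    have "\<exists>y\<in>K. dist y x < e" if "e > 0" for e
    proof -
      from attr[of "e/2"] that obtain N where
        N: "\<And>t z. N \<le> t \<Longrightarrow> z \<in> B t \<Longrightarrow> \<exists>y\<in>K. dist z y < e/2"
        by (auto simp: eventually_at_top_linorder)
      have "x \<in> closure (\<Union>t\<in>{max 0 N..}. B t)" using x unfolding L_def by auto
      then obtain z where "z \<in> (\<Union>t\<in>{max 0 N..}. B t)" and zx: "dist z x < e/2"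
        using half_gt_zero[OF \<open>e > 0\<close>] unfolding closure_approachable by blast
      then obtain t where "N \<le> t" "z \<in> B t" by auto
      with N obtain y where "y \<in> K" "dist z y < e/2" by blast
      with zx have "dist y x < e" using dist_triangle_half_r by blast
      with \<open>y \<in> K\<close> show ?thesis by blast
    qed
    then have "x \<in> closure K" unfolding closure_approachable by blast
    with \<open>compact K\<close> show "x \<in> K" by (simp add: compact_imp_closed)
  qed
  show attrL: "eventually (\<lambda>t. \<forall>x\<in>B t. \<exists>y\<in>L. dist x y < e) at_top" if "e > 0" for e
  proof (rule ccontr)
    assume neg: "\<not> ?thesis"
    have "\<exists>t x y. int k \<le> t \<and> x \<in> B t \<and> (\<forall>z\<in>L. e \<le> dist x z) \<and>
        y \<in> K \<and> dist x y < inverse (real (Suc k))" for k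
    proof -
      from attr[of "inverse (real (Suc k))"] obtain N where
        N: "\<And>t z. N \<le> t \<Longrightarrow> z \<in> B t \<Longrightarrow> \<exists>y\<in>K. dist z y < inverse (real (Suc k))"
        by (auto simp: eventually_at_top_linorder)
      from neg obtain t x where "max N (int k) \<le> t" "x \<in> B t" "\<forall>z\<in>L. e \<le> dist x z"
        unfolding eventually_at_top_linorder by (meson not_less)
      with N show ?thesis by (meson max.boundedE)
    qed
    then obtain t x y where t: "\<And>k. int k \<le> t k" and x: "\<And>k. x k \<in> B (t k)"
      and far: "\<And>k z. z \<in> L \<Longrightarrow> e \<le> dist (x k) z"
      and y: "\<And>k. y k \<in> K" and xy: "\<And>k. dist (x k) (y k) < inverse (real (Suc k))"
      by metis
    from \<open>compact K\<close> y obtain l r where "strict_mono r" and lim_y: "(y \<circ> r) \<longlonglongrightarrow> l"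
      unfolding compact_def by metis
    have "(\<lambda>k. dist (x k) (y k)) \<longlonglongrightarrow> 0"
      by (rule real_tendsto_sandwich[OF always_eventually always_eventually
            tendsto_const LIMSEQ_inverse_real_of_nat])
        (simp, intro allI less_imp_le[OF xy])
    then have "((\<lambda>k. dist (x k) (y k)) \<circ> r) \<longlonglongrightarrow> 0"
      using \<open>strict_mono r\<close> by (rule LIMSEQ_subseq_LIMSEQ)
    moreover from lim_y have "(\<lambda>k. dist ((y \<circ> r) k) l) \<longlonglongrightarrow> 0"
      by (rule iffD1[OF tendsto_dist_iff])
    ultimately have sum: "(\<lambda>k. dist (x (r k)) (y (r k)) + dist (y (r k)) l) \<longlonglongrightarrow> 0"
      unfolding o_def by (rule tendsto_add_zero)
    have "(\<lambda>k. dist (x (r k)) l) \<longlonglongrightarrow> 0"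
      by (rule real_tendsto_sandwich[OF always_eventually always_eventually tendsto_const sum])
        (simp, intro allI dist_triangle)
    then have lim_x: "(x \<circ> r) \<longlonglongrightarrow> l"
      unfolding o_def by (rule iffD2[OF tendsto_dist_iff])
    have "l \<in> L"
      unfolding L_def
    proof (intro INT_I)
      fix s :: int assume "s \<in> {0..}"
      have "eventually (\<lambda>k. (x \<circ> r) k \<in> closure (\<Union>t\<in>{s..}. B t)) sequentially"
      proof (rule eventually_sequentiallyI)
        fix k assume "nat s \<le> k"
        then have "s \<le> int (r k)" using seq_suble[OF \<open>strict_mono r\<close>, of k] by linarith
        also have "\<dots> \<le> t (r k)" by (rule t)
        finally have "(x \<circ> r) k \<in> (\<Union>t\<in>{s..}. B t)" using x[of "r k"] by auto
        then show "(x \<circ> r) k \<in> closure (\<Union>t\<in>{s..}. B t)" by (rule subsetD[OF closure_subset])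
      qed
      then show "l \<in> closure (\<Union>t\<in>{s..}. B t)"
        by (rule Lim_in_closed_set[OF closed_closure _ sequentially_bot lim_x])
    qed
    moreover from lim_x \<open>e > 0\<close> obtain k where "dist (x (r k)) l < e"
      unfolding lim_sequentially by auto
    ultimately show False using far[of l "r k"] by simp
  qed
  show "L \<noteq> {}" if "\<And>t. B t \<noteq> {}"
    using eventually_happens'[OF trivial_limit_at_top_linorder attrL[OF zero_less_one]] that
    by blast
qed

section \<open>Restarting the general solution\<close>

lemma discrete_interval_upward_closed:
  assumes "discrete_interval I" and "\<not> bdd_above I" and "\<tau> \<in> I" and "\<tau> \<le> t"
  shows "t \<in> I"
proof -
  from assms(1) obtain J :: "real set" where J: "is_interval J" "I = {t. real_of_int t \<in> J}"
    unfolding discrete_interval_def by blast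
  from assms(2) obtain t' where "t' \<in> I" "t \<le> t'"
    unfolding bdd_above_def by (meson linear)
  with J assms show ?thesis
    by (auto intro: mem_is_interval_1_I[of J "real_of_int \<tau>" "real_of_int t'"])
qed

lemma gen_sol_cocycle:
  assumes "\<tau> \<le> \<sigma>" and "\<sigma> \<le> t"
  shows "gen_sol f t \<sigma> (gen_sol f \<sigma> \<tau> u) = gen_sol f t \<tau> u"
  using assms(2)
proof (induction t rule: int_ge_induct)
  case (step t)
  with assms(1) show ?case by (simp add: gen_sol_step)
qed (simp add: gen_sol_refl)

lemma gen_sol_in_fiber:
  assumes "discrete_interval I" and "\<not> bdd_above I" and "positively_invariant I f A"
    and "\<tau> \<in> I" and "\<tau> \<le> t" and "u \<in> fiber A \<tau>"
  shows "gen_sol f t \<tau> u \<in> fiber A t"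
  using assms(5)
proof (induction t rule: int_ge_induct)
  case (step t)
  moreover have "t \<in> I" using discrete_interval_upward_closed[OF assms(1,2,4)] step by simp
  ultimately show ?case
    using assms(3) by (auto simp: gen_sol_step positively_invariant_def)
qed (use assms(6) in \<open>simp add: gen_sol_refl\<close>)

section \<open>Attraction by the compact set\<close>

text \<open>Choosing, for every threshold \<open>N\<close>, an initial time and a time span beyond \<open>N\<close> that
  violate the estimate would produce sequences contradicting the sequential definition.\<close>

lemma strongly_asymptotically_compact_uniform:
  assumes sac: "strongly_asymptotically_compact I U f A K" and "e > 0"
  shows "\<exists>N. \<forall>\<tau>\<in>I. \<forall>s. N \<le> \<tau> \<longrightarrow> N \<le> s \<longrightarrow>
           (\<forall>u\<in>fiber A \<tau>. \<exists>y\<in>K. dist (gen_sol f (\<tau> + s) \<tau> u) y < e)"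
proof (rule ccontr)
  assume "\<not> ?thesis"
  then have "\<exists>\<tau> s. \<tau> \<in> I \<and> N \<le> \<tau> \<and> N \<le> s \<and>
      \<not> (\<forall>x\<in>gen_sol f (\<tau> + s) \<tau> ` fiber A \<tau>. \<exists>y\<in>K. dist x y < e)" for N
    by simp blast
  then obtain \<tau> s where bad: "\<And>N. \<tau> N \<in> I" "\<And>N. N \<le> \<tau> N" "\<And>N. N \<le> s N"
    "\<And>N. \<not> (\<forall>x\<in>gen_sol f (\<tau> N + s N) (\<tau> N) ` fiber A (\<tau> N). \<exists>y\<in>K. dist x y < e)"
    by metis
  \<comment> \<open>The shift by one keeps the time spans positive, as the definition requires.\<close>
  let ?N = "\<lambda>k::nat. int k + 1"
  have N_lim: "filterlim ?N at_top sequentially"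
    by (rule filterlim_at_top_mono[OF filterlim_int_sequentially]) simp
  have "1 \<le> s (?N k)" for k using bad(3)[of "?N k"] by simp
  moreover have "filterlim (\<lambda>k. s (?N k)) at_top sequentially"
    by (rule filterlim_at_top_mono[OF N_lim]) (use bad(3) in simp)
  moreover have "filterlim (\<lambda>k. \<tau> (?N k)) at_top sequentially"
    by (rule filterlim_at_top_mono[OF N_lim]) (use bad(2) in simp)
  ultimately have "(\<lambda>k. hausdorff_semidist
      (gen_sol f (\<tau> (?N k) + s (?N k)) (\<tau> (?N k)) ` fiber A (\<tau> (?N k))) K) \<longlonglongrightarrow> 0"
    using sac bad(1)
    unfolding strongly_asymptotically_compact_def
    by (elim conjE allE[of _ "\<lambda>k. s (?N k)"] allE[of _ "\<lambda>k. \<tau> (?N k)"]) blast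
  then have "eventually (\<lambda>k. \<forall>x\<in>gen_sol f (\<tau> (?N k) + s (?N k)) (\<tau> (?N k)) ` fiber A (\<tau> (?N k)).
      \<exists>y\<in>K. dist x y < e) sequentially"
    using \<open>e > 0\<close> unfolding tendsto_hausdorff_semidist_0_iff by blast
  then show False using eventually_happens'[OF sequentially_bot] bad(4) by blast
qed

text \<open>Although the hypothesis concerns late initial times only, the conclusion holds for every
  initial time: the state at the late time is again in the fiber of \<open>A\<close>.\<close>

lemma eventually_gen_sol_near_compact:
  assumes "discrete_interval I" and "\<not> bdd_above I" and "positively_invariant I f A"
    and "strongly_asymptotically_compact I U f A K" and "\<tau> \<in> I" and "e > 0"
  shows "eventually (\<lambda>t. \<forall>x\<in>gen_sol f (\<tau> + t) \<tau> ` fiber A \<tau>. \<exists>y\<in>K. dist x y < e) at_top"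
proof -
  from strongly_asymptotically_compact_uniform[OF assms(4,6)] obtain N where
    N: "\<And>\<sigma> s u. \<sigma> \<in> I \<Longrightarrow> N \<le> \<sigma> \<Longrightarrow> N \<le> s \<Longrightarrow> u \<in> fiber A \<sigma> \<Longrightarrow>
          \<exists>y\<in>K. dist (gen_sol f (\<sigma> + s) \<sigma> u) y < e"
    by blast
  define \<sigma> where "\<sigma> = max \<tau> N"
  have \<sigma>: "\<sigma> \<in> I" "\<tau> \<le> \<sigma>" "N \<le> \<sigma>"
    using discrete_interval_upward_closed[OF assms(1,2,5)] by (auto simp: \<sigma>_def)
  have "\<exists>y\<in>K. dist (gen_sol f (\<tau> + t) \<tau> u) y < e"
    if t: "max 0 N + (\<sigma> - \<tau>) \<le> t" and u: "u \<in> fiber A \<tau>" for t u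
  proof -
    have "gen_sol f \<sigma> \<tau> u \<in> fiber A \<sigma>"
      using gen_sol_in_fiber[OF assms(1-3,5)] \<sigma>(2) u by blast
    with N[of \<sigma> "\<tau> + t - \<sigma>"] \<sigma> t
    have "\<exists>y\<in>K. dist (gen_sol f (\<tau> + t) \<sigma> (gen_sol f \<sigma> \<tau> u)) y < e" by simp
    moreover have "gen_sol f (\<tau> + t) \<sigma> (gen_sol f \<sigma> \<tau> u) = gen_sol f (\<tau> + t) \<tau> u"
      using \<sigma> t by (intro gen_sol_cocycle) auto
    ultimately show ?thesis by simp
  qed
  then show ?thesis unfolding eventually_at_top_linorder by blast
qed

section \<open>Forward limit sets\<close>

lemma forward_limit_set_properties:
  assumes I: "discrete_interval I" "\<not> bdd_above I" and "nonautonomous_set I U A"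
    and inv: "positively_invariant I f A"
    and sac: "strongly_asymptotically_compact I U f A K"
  shows "forward_limit_set I f A \<subseteq> K"
    and "forward_limit_set I f A \<noteq> {}"
    and "compact (forward_limit_set I f A)"
    and "forward_attracts I U f A (forward_limit_set I f A)"
proof -
  from sac have K: "K \<subseteq> U" "compact K" unfolding strongly_asymptotically_compact_def by auto
  have Omega: "Omega_fiber f A \<tau> \<subseteq> K" "Omega_fiber f A \<tau> \<noteq> {}"
    "\<And>e. e > 0 \<Longrightarrow> eventually (\<lambda>t. \<forall>x\<in>gen_sol f (\<tau> + t) \<tau> ` fiber A \<tau>.
        \<exists>y\<in>Omega_fiber f A \<tau>. dist x y < e) at_top"
    if "\<tau> \<in> I" for \<tau>
  proof -
    have attracted: "eventually (\<lambda>t. \<forall>x\<in>gen_sol f (\<tau> + t) \<tau> ` fiber A \<tau>.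
        \<exists>y\<in>K. dist x y < e) at_top" if "e > 0" for e
      using I inv sac \<open>\<tau> \<in> I\<close> that by (rule eventually_gen_sol_near_compact)
    note limit_set = limit_set_of_compactly_attracted
      [where B = "\<lambda>t. gen_sol f (\<tau> + t) \<tau> ` fiber A \<tau>", folded Omega_fiber_def,
        OF \<open>compact K\<close> attracted]
    show "Omega_fiber f A \<tau> \<subseteq> K" by (rule limit_set(1))
    have "fiber A \<tau> \<noteq> {}" using assms(3) that unfolding nonautonomous_set_def by blast
    then show "Omega_fiber f A \<tau> \<noteq> {}" by (intro limit_set(3)) simp_all
    show "eventually (\<lambda>t. \<forall>x\<in>gen_sol f (\<tau> + t) \<tau> ` fiber A \<tau>.
        \<exists>y\<in>Omega_fiber f A \<tau>. dist x y < e) at_top" if "e > 0" for e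
      using that by (intro limit_set(2))
  qed
  have sub: "Omega_fiber f A \<tau> \<subseteq> forward_limit_set I f A" if "\<tau> \<in> I" for \<tau>
    unfolding forward_limit_set_def using that
    by (intro subset_trans[OF UN_upper closure_subset])
  show "forward_limit_set I f A \<subseteq> K"
    unfolding forward_limit_set_def
    by (intro closure_minimal compact_imp_closed[OF \<open>compact K\<close>] UN_least Omega(1))
  then show "compact (forward_limit_set I f A)"
    using \<open>compact K\<close> compact_Int_closed[of K "forward_limit_set I f A"]
    by (simp add: forward_limit_set_def Int_absorb1)
  have "I \<noteq> {}" using I(2) by auto
  with sub Omega(2) show "forward_limit_set I f A \<noteq> {}" by blast
  have "((\<lambda>s. hausdorff_semidist (gen_sol f (\<tau> + s) \<tau> ` fiber A \<tau>) (forward_limit_set I f A))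
      \<longlongrightarrow> 0) at_top" if "\<tau> \<in> I" for \<tau>
    unfolding tendsto_hausdorff_semidist_0_iff
  proof (intro allI impI)
    fix e :: real assume "e > 0"
    with Omega(3)[OF that]
    have "eventually (\<lambda>t. \<forall>x\<in>gen_sol f (\<tau> + t) \<tau> ` fiber A \<tau>. \<exists>y\<in>Omega_fiber f A \<tau>. dist x y < e) at_top"
      by blast
    then show "eventually (\<lambda>t. \<forall>x\<in>gen_sol f (\<tau> + t) \<tau> ` fiber A \<tau>.
        \<exists>y\<in>forward_limit_set I f A. dist x y < e) at_top"
      by eventually_elim (use sub[OF that] in blast)
  qed
  with \<open>forward_limit_set I f A \<subseteq> K\<close> \<open>K \<subseteq> U\<close>
  show "forward_attracts I U f A (forward_limit_set I f A)"
    unfolding forward_attracts_def by blast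
qed

text \<open>A limit set is close to \<open>M\<close> as soon as the evolution from every initial time is
  eventually close to \<open>M\<close>; the three approximations below give this closeness by comparing the
  last \<open>S\<close> steps of the evolution under \<open>f\<close> with the evolution under \<open>g\<close> of a point of \<open>K\<close>.\<close>

lemma forward_limit_set_near:
  assumes I: "discrete_interval I" "\<not> bdd_above I"
    and inv: "positively_invariant I f A"
    and sac: "strongly_asymptotically_compact I U f A K"
    and "0 \<le> S" and "e > 0" and "d > 0"
    and equicont: "\<And>\<sigma> y z. \<sigma> \<in> I \<Longrightarrow> y \<in> fiber A \<sigma> \<Longrightarrow> z \<in> K \<Longrightarrow> dist y z < d \<Longrightarrow>
        dist (gen_sol f (\<sigma> + S) \<sigma> y) (gen_sol f (\<sigma> + S) \<sigma> z) < e"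
    and approx: "\<And>\<sigma> z. \<sigma> \<in> I \<Longrightarrow> z \<in> K \<Longrightarrow>
        dist (gen_sol f (\<sigma> + S) \<sigma> z) (gen_sol g (\<sigma> + S) \<sigma> z) < e"
    and attr: "\<And>\<sigma> z. \<sigma> \<in> I \<Longrightarrow> z \<in> K \<Longrightarrow> \<exists>w\<in>M. dist (gen_sol g (\<sigma> + S) \<sigma> z) w < e"
    and x: "x \<in> forward_limit_set I f A"
  shows "\<exists>w\<in>M. dist x w < 5 * e"
proof -
  from x \<open>e > 0\<close> obtain x' \<tau> where \<tau>: "\<tau> \<in> I" and x': "x' \<in> Omega_fiber f A \<tau>" "dist x' x < e"
    unfolding forward_limit_set_def closure_approachable by blast
  from eventually_gen_sol_near_compact[OF I inv sac \<tau> \<open>d > 0\<close>] obtain N where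
    N: "\<And>t u. N \<le> t \<Longrightarrow> u \<in> fiber A \<tau> \<Longrightarrow> \<exists>z\<in>K. dist (gen_sol f (\<tau> + t) \<tau> u) z < d"
    unfolding eventually_at_top_linorder by blast
  define T where "T = max 0 N + S"
  have "x' \<in> closure (\<Union>t\<in>{T..}. gen_sol f (\<tau> + t) \<tau> ` fiber A \<tau>)"
    using x'(1) \<open>0 \<le> S\<close> unfolding Omega_fiber_def T_def by auto
  with \<open>e > 0\<close> obtain t u where t: "T \<le> t" and u: "u \<in> fiber A \<tau>"
    and near: "dist (gen_sol f (\<tau> + t) \<tau> u) x' < e"
    unfolding closure_approachable by blast
  define \<sigma> where "\<sigma> = \<tau> + t - S"
  define y where "y = gen_sol f \<sigma> \<tau> u"
  have "\<tau> \<le> \<sigma>" using t by (simp add: \<sigma>_def T_def)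
  have "\<sigma> \<in> I" using discrete_interval_upward_closed[OF I \<tau> \<open>\<tau> \<le> \<sigma>\<close>] .
  have y: "y \<in> fiber A \<sigma>"
    unfolding y_def by (rule gen_sol_in_fiber[OF I inv \<tau> \<open>\<tau> \<le> \<sigma>\<close> u])
  have "N \<le> t - S" using t by (simp add: T_def)
  from N[OF this u] obtain z where z: "z \<in> K" "dist y z < d"
    by (auto simp: y_def \<sigma>_def algebra_simps)
  have "gen_sol f (\<sigma> + S) \<sigma> y = gen_sol f (\<tau> + t) \<tau> u"
    unfolding y_def using gen_sol_cocycle[OF \<open>\<tau> \<le> \<sigma>\<close>, of "\<sigma> + S"] \<open>0 \<le> S\<close> by (simp add: \<sigma>_def)
  with near have "dist (gen_sol f (\<sigma> + S) \<sigma> y) x' < e" by simp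
  moreover note x'(2) equicont[OF \<open>\<sigma> \<in> I\<close> y z] approx[OF \<open>\<sigma> \<in> I\<close> z(1)]
  moreover from attr[OF \<open>\<sigma> \<in> I\<close> z(1)] obtain w where
    "w \<in> M" "dist (gen_sol g (\<sigma> + S) \<sigma> z) w < e" by blast
  ultimately have "dist x w < 5 * e"
    using dist_triangle[of x w x'] dist_triangle[of x' w "gen_sol f (\<sigma> + S) \<sigma> y"]
      dist_triangle[of "gen_sol f (\<sigma> + S) \<sigma> y" w "gen_sol f (\<sigma> + S) \<sigma> z"]
      dist_triangle[of "gen_sol f (\<sigma> + S) \<sigma> z" w "gen_sol g (\<sigma> + S) \<sigma> z"]
    by (simp add: dist_commute)
  with \<open>w \<in> M\<close> show ?thesis by blast
qed

section \<open>Upper semicontinuity of forward limit sets\<close>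

text \<open>The maxima in the hypotheses below run over all time spans up to \<open>S\<close>; the comparison of
  the last \<open>S\<close> steps uses them at the full time span.\<close>

lemma le_Max_greaterThanAtMost:
  fixes h :: "int \<Rightarrow> real"
  assumes "1 \<le> S"
  shows "h S \<le> (MAX s\<in>{0<..S}. h s)"
  using assms by (intro Max_ge) auto

theorem theorem2p7:
  fixes I :: "int set"
    and U :: "'a::complete_space set"
    and F :: "nat \<Rightarrow> int \<Rightarrow> 'a \<Rightarrow> 'a"
    and A :: "(int \<times> 'a) set"
    and K :: "nat \<Rightarrow> 'a set"
  assumes "discrete_interval I" and "\<not> bdd_above I"
    and "U \<noteq> {}" and "closed U"
    and "\<And>n t. t \<in> I \<Longrightarrow> F n t ` U \<subseteq> U"
    and "\<And>n t. t \<in> I \<Longrightarrow> continuous_on U (F n t)"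
    and "nonautonomous_set I U A"
    and "bounded_nonautonomous I A"
    and "\<And>n. positively_invariant I (F n) A"
    and "\<And>n. strongly_asymptotically_compact I U (F n) A (K n)"
  shows "(\<forall>n. forward_limit_set I (F n) A \<subseteq> K n \<and>
              forward_limit_set I (F n) A \<noteq> {} \<and>
              compact (forward_limit_set I (F n) A) \<and>
              forward_attracts I U (F n) A (forward_limit_set I (F n) A))
    \<and>
    (((\<lambda>s. SUP \<tau>\<in>I. hausdorff_semidist (gen_sol (F 0) (\<tau> + s) \<tau> ` (\<Union>n. K n))
                       (forward_limit_set I (F 0) A)) \<longlongrightarrow> 0) at_top
     \<longrightarrow>
     (\<forall>(s :: nat \<Rightarrow> int) (\<tau> :: nat \<Rightarrow> int).
        (\<forall>k. 1 \<le> s k \<and> \<tau> k \<in> I) \<and> filterlim \<tau> at_top sequentially \<longrightarrow>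
        (\<forall>n. (\<lambda>k. hausdorff_semidist (gen_sol (F n) (\<tau> k + s k) (\<tau> k) ` K n) (K n))
                \<longlonglongrightarrow> 0))
     \<longrightarrow>
     (\<forall>\<epsilon>>0. \<forall>S\<ge>1. \<forall>n. \<exists>\<delta>>0. \<forall>\<tau>\<in>I.
        \<forall>u\<in>fiber A \<tau> \<union> K n. \<forall>v\<in>fiber A \<tau> \<union> K n. dist u v < \<delta> \<longrightarrow>
          (MAX s\<in>{0<..S}. dist (gen_sol (F n) (\<tau> + s) \<tau> u) (gen_sol (F n) (\<tau> + s) \<tau> v)) < \<epsilon>)
     \<longrightarrow>
     (\<forall>\<epsilon>>0. \<forall>S\<ge>1. \<exists>n0\<ge>1. \<forall>\<tau>\<in>I. \<forall>u\<in>fiber A \<tau> \<union> (\<Union>n. K n). \<forall>n>n0.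
          (MAX s\<in>{0<..S}. dist (gen_sol (F n) (\<tau> + s) \<tau> u) (gen_sol (F 0) (\<tau> + s) \<tau> u)) < \<epsilon>)
     \<longrightarrow>
     (\<lambda>n. hausdorff_semidist (forward_limit_set I (F n) A) (forward_limit_set I (F 0) A))
       \<longlonglongrightarrow> 0)"
proof (intro conjI allI impI)
  fix n
  note props = forward_limit_set_properties[OF assms(1,2,7,9,10), of n]
  show "forward_limit_set I (F n) A \<subseteq> K n" by (rule props)
  show "forward_limit_set I (F n) A \<noteq> {}" by (rule props)
  show "compact (forward_limit_set I (F n) A)" by (rule props)
  show "forward_attracts I U (F n) A (forward_limit_set I (F n) A)" by (rule props)
next
  let ?M = "forward_limit_set I (F 0) A"
  assume attr: "((\<lambda>s. SUP \<tau>\<in>I. hausdorff_semidist (gen_sol (F 0) (\<tau> + s) \<tau> ` (\<Union>n. K n)) ?M)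
      \<longlongrightarrow> 0) at_top"
    and equicont: "\<forall>\<epsilon>>0. \<forall>S\<ge>1. \<forall>n. \<exists>\<delta>>0. \<forall>\<tau>\<in>I.
        \<forall>u\<in>fiber A \<tau> \<union> K n. \<forall>v\<in>fiber A \<tau> \<union> K n. dist u v < \<delta> \<longrightarrow>
          (MAX s\<in>{0<..S}. dist (gen_sol (F n) (\<tau> + s) \<tau> u) (gen_sol (F n) (\<tau> + s) \<tau> v)) < \<epsilon>"
    and approx: "\<forall>\<epsilon>>0. \<forall>S\<ge>1. \<exists>n0\<ge>1. \<forall>\<tau>\<in>I. \<forall>u\<in>fiber A \<tau> \<union> (\<Union>n. K n). \<forall>n>n0.
          (MAX s\<in>{0<..S}. dist (gen_sol (F n) (\<tau> + s) \<tau> u) (gen_sol (F 0) (\<tau> + s) \<tau> u)) < \<epsilon>"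
  show "(\<lambda>n. hausdorff_semidist (forward_limit_set I (F n) A) ?M) \<longlonglongrightarrow> 0"
    unfolding tendsto_hausdorff_semidist_0_iff
  proof (intro allI impI)
    fix \<epsilon> :: real assume "\<epsilon> > 0"
    \<comment> \<open>Three comparisons over the last steps, and one approximation for each of the two closures
      in the definition of the forward limit set.\<close>
    define e where "e = \<epsilon> / 5"
    have "e > 0" using \<open>\<epsilon> > 0\<close> by (simp add: e_def)
    have "eventually (\<lambda>S. 1 \<le> S \<and> (SUP \<tau>\<in>I. hausdorff_semidist
        (gen_sol (F 0) (\<tau> + S) \<tau> ` (\<Union>n. K n)) ?M) < ennreal e) at_top"
      by (intro eventually_conj eventually_ge_at_top
          eventually_less_of_tendsto_0_ennreal[OF attr \<open>e > 0\<close>])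
    then obtain S where S: "1 \<le> S" "(SUP \<tau>\<in>I. hausdorff_semidist
        (gen_sol (F 0) (\<tau> + S) \<tau> ` (\<Union>n. K n)) ?M) < ennreal e"
      by (auto simp: eventually_at_top_linorder)
    have attr_S: "\<exists>w\<in>?M. dist (gen_sol (F 0) (\<sigma> + S) \<sigma> z) w < e"
      if "\<sigma> \<in> I" "z \<in> K n" for \<sigma> z n
    proof -
      have "hausdorff_semidist (gen_sol (F 0) (\<sigma> + S) \<sigma> ` (\<Union>n. K n)) ?M < ennreal e"
        using S(2) that(1) by (meson SUP_upper le_less_trans)
      then show ?thesis by (rule hausdorff_semidist_lessD) (use that(2) in blast)
    qed
    from approx \<open>e > 0\<close> S(1) obtain n0 where
      n0: "\<forall>\<tau>\<in>I. \<forall>u\<in>fiber A \<tau> \<union> (\<Union>n. K n). \<forall>n>n0.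
        (MAX s\<in>{0<..S}. dist (gen_sol (F n) (\<tau> + s) \<tau> u) (gen_sol (F 0) (\<tau> + s) \<tau> u)) < e"
      by blast
    show "eventually (\<lambda>n. \<forall>x\<in>forward_limit_set I (F n) A. \<exists>w\<in>?M. dist x w < \<epsilon>) sequentially"
      using eventually_gt_at_top[of n0]
    proof eventually_elim
      case (elim n)
      from equicont \<open>e > 0\<close> S(1) obtain d where "d > 0" and
        d: "\<forall>\<tau>\<in>I. \<forall>u\<in>fiber A \<tau> \<union> K n. \<forall>v\<in>fiber A \<tau> \<union> K n. dist u v < d \<longrightarrow>
          (MAX s\<in>{0<..S}. dist (gen_sol (F n) (\<tau> + s) \<tau> u) (gen_sol (F n) (\<tau> + s) \<tau> v)) < e"
        by blast
      have "\<exists>w\<in>?M. dist x w < 5 * e" if "x \<in> forward_limit_set I (F n) A" for x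
      proof (rule forward_limit_set_near[OF assms(1,2,9,10) _ \<open>e > 0\<close> \<open>d > 0\<close> _ _ _ that,
            where S = S and g = "F 0"])
        show "dist (gen_sol (F n) (\<sigma> + S) \<sigma> y) (gen_sol (F n) (\<sigma> + S) \<sigma> z) < e"
          if "\<sigma> \<in> I" "y \<in> fiber A \<sigma>" "z \<in> K n" "dist y z < d" for \<sigma> y z
        proof (rule le_less_trans[OF le_Max_greaterThanAtMost[OF S(1)]])
          show "(MAX s\<in>{0<..S}. dist (gen_sol (F n) (\<sigma> + s) \<sigma> y) (gen_sol (F n) (\<sigma> + s) \<sigma> z)) < e"
            using d that by blast
        qed
        show "dist (gen_sol (F n) (\<sigma> + S) \<sigma> z) (gen_sol (F 0) (\<sigma> + S) \<sigma> z) < e"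
          if "\<sigma> \<in> I" "z \<in> K n" for \<sigma> z
        proof (rule le_less_trans[OF le_Max_greaterThanAtMost[OF S(1)]])
          show "(MAX s\<in>{0<..S}. dist (gen_sol (F n) (\<sigma> + s) \<sigma> z) (gen_sol (F 0) (\<sigma> + s) \<sigma> z)) < e"
            using n0 that elim by blast
        qed
      qed (use S(1) attr_S in auto)
      then show ?case by (simp add: e_def)
    qed
  qed
qed

end
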